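(* Let $\gamma>0$ and $\tau>0$ satisfy $\gamma\in(0,2/\nu)$ and $\tau\gamma\|L\|^2<1$. Let $p^0\in\mathcal{X}$, $y^0\in\mathcal{Y}$ be arbitrary, and let the sequences $(x^k)_{k\in\mathbb{N}}$, $(s^{k})_{k\ge 1}$, $(y^k)_{k\in\mathbb{N}}$, $(p^k)_{k\in\mathbb N}$ be generated by the PDDY algorithm: for $k=0,1,2,\dots$ $$\begin{aligned} y^{k+1}&=\mathrm{prox}_{\tau H^*}\big(y^k+\tau L(p^k-\gamma L^*y^k)\big),\\ x^k&=p^k-\gamma L^*y^{k+1},\\ s^{k+1}&=\mathrm{prox}_{\gamma R}\big(2x^k-p^k-\gamma\nabla F(x^k)\big),\\ p^{k+1}&=p^k+s^{k+1}-x^k.\end{aligned}$$ Then the sequences $(x^k)$ and $(s^k)$ converge to the same point $x^\star$, which is a solution of $\min_{x\in\mathcal{X}}\{F(x)+R(x)+H(Lx)\}$, and the sequence $(y^k)$ converges to some solution $y^\star$ of the dual problem $\min_{y\in\mathcal{Y}}\{(F+R)^*(-L^*y)+H^*(y)\}$.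
   Context: $\mathcal{X},\mathcal{Y}$ are finite-dimensional real Hilbert spaces, $L:\mathcal{X}\to\mathcal{Y}$ is a linear operator with adjoint $L^*$ and operator norm $\|L\|$. $F:\mathcal{X}\to\mathbb{R}$ is convex and $\nu$-smooth for some $\nu>0$ (differentiable with $\nu$-Lipschitz gradient). $R:\mathcal{X}\to\mathbb{R}\cup\{+\infty\}$ and $H:\mathcal{Y}\to\mathbb{R}\cup\{+\infty\}$ are proper, convex, lower semicontinuous. $G^*$ denotes the convex conjugate of $G$, $\partial G$ its subdifferential, and $\mathrm{prox}_G(z)=\arg\min_{z'}\{G(z')+\tfrac12\|z-z'\|^2\}$. Standing assumption: there exists $\hat x\in\mathcal{X}$ with $0\in\nabla F(\hat x)+\partial R(\hat x)+L^*\partial H(L\hat x)$. *)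

theory Defs
  imports "HOL-Analysis.Analysis"
begin

text \<open>Functions into \<open>\<real> \<union> {+\<infinity>}\<close> are rendered as \<^typ>\<open>ereal\<close>-valued functions that
  never take the value \<open>-\<infinity>\<close>, which is part of properness.\<close>

definition proper_fun :: "('a \<Rightarrow> ereal) \<Rightarrow> bool" where
  "proper_fun G \<longleftrightarrow> (\<forall>x. G x \<noteq> -\<infinity>) \<and> (\<exists>x. G x \<noteq> \<infinity>)"

text \<open>The library's \<^const>\<open>convex_on\<close> only covers real-valued functions. At
  \<open>u = 0\<close> or \<open>v = 0\<close> the inequality relies on \<open>0 * \<infinity> = 0\<close>.\<close>

definition convex_fun :: "('a::real_vector \<Rightarrow> ereal) \<Rightarrow> bool" where
  "convex_fun G \<longleftrightarrow>
    (\<forall>x y. \<forall>u\<ge>0. \<forall>v\<ge>0. u + v = 1 \<longrightarrow>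
      G (u *\<^sub>R x + v *\<^sub>R y) \<le> ereal u * G x + ereal v * G y)"

definition lsc :: "('a::topological_space \<Rightarrow> ereal) \<Rightarrow> bool" where
  "lsc G \<longleftrightarrow> (\<forall>x. G x \<le> Liminf (at x) G)"

text \<open>For proper \<open>G\<close> this is empty at points where \<open>G\<close> is \<open>+\<infinity>\<close>.\<close>

definition subdifferential :: "('a::real_inner \<Rightarrow> ereal) \<Rightarrow> 'a \<Rightarrow> 'a set" where
  "subdifferential G x = {g. \<forall>z. G x + ereal (g \<bullet> (z - x)) \<le> G z}"

definition conjugate :: "('a::real_inner \<Rightarrow> ereal) \<Rightarrow> 'a \<Rightarrow> ereal" where
  "conjugate G y = (SUP x. ereal (x \<bullet> y) - G x)"

text \<open>\<^const>\<open>arg_min\<close> picks some minimizer; for proper, convex, lower semicontinuous \<open>G\<close>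
  on a finite-dimensional space the minimizer exists and is unique.\<close>

definition prox :: "('a::real_inner \<Rightarrow> ereal) \<Rightarrow> 'a \<Rightarrow> 'a" where
  "prox G z = arg_min (\<lambda>z'. G z' + ereal ((norm (z - z'))\<^sup>2 / 2)) (\<lambda>_. True)"

end

theory Submission
  imports Defs
begin

text \<open>A saddle point is a pair \<open>(x, y)\<close> with \<open>L x \<in> \<partial>H\<^sup>*(y)\<close> and \<open>- L\<^sup>* y - \<nabla>F(x) \<in> \<partial>R(x)\<close>; its
  components solve the primal and the dual problem. Writing the two proximal steps as inclusions and
  using the monotonicity of the subdifferentials and the cocoercivity of \<open>\<nabla>F\<close>, the energy
  \<open>\<parallel>y\<^sup>k - y\<parallel>\<^sup>2 / \<tau> - \<gamma> \<parallel>L\<^sup>*(y\<^sup>k - y)\<parallel>\<^sup>2 + \<parallel>p\<^sup>k - x - \<gamma> L\<^sup>* y\<parallel>\<^sup>2 / \<gamma>\<close> decreases for every saddle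
  point, by at least a positive multiple of \<open>\<parallel>y\<^sup>k - y\<^sup>k\<^sup>+\<^sup>1\<parallel>\<^sup>2 + \<parallel>x\<^sup>k - s\<^sup>k\<^sup>+\<^sup>1\<parallel>\<^sup>2\<close>. Hence these gaps tend
  to zero, every cluster point is a saddle point because the subdifferentials have closed graphs,
  and the energy relative to a cluster point tends to zero.\<close>

section \<open>Finite-dimensional inner product spaces\<close>

text \<open>Finite dimension is given by a finite spanning set, so coordinates come from an
  orthogonalized set \<open>C\<close>: the residual \<open>e\<close> is orthogonal to
  \<open>C\<close>, hence to its whole span and to itself. Elements of \<open>C\<close> need not be
  unit vectors, and a zero vector contributes nothing.\<close>

lemma finite_span_orthogonal_expansion:
  fixes B :: "'a::real_inner set"
  assumes "finite B" "span B = UNIV"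
  obtains C :: "'a set" where "finite C"
    and "\<And>x. x = (\<Sum>b\<in>C. ((x \<bullet> b) / (b \<bullet> b)) *\<^sub>R b)"
proof -
  obtain C :: "'a set" where C: "finite C" "span C = UNIV" "pairwise orthogonal C"
    using basis_orthogonal[OF assms(1)] assms(2) by auto
  have "x = (\<Sum>b\<in>C. ((x \<bullet> b) / (b \<bullet> b)) *\<^sub>R b)" for x
  proof -
    define e where "e = x - (\<Sum>b\<in>C. ((x \<bullet> b) / (b \<bullet> b)) *\<^sub>R b)"
    have "orthogonal e c" if c: "c \<in> C" for c
    proof -
      have "(\<Sum>b\<in>C. ((x \<bullet> b) / (b \<bullet> b)) * (b \<bullet> c)) = (\<Sum>b\<in>C. if b = c then x \<bullet> c else 0)"
        using C(3) c by (intro sum.cong) (auto simp: pairwise_def orthogonal_def)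
      then have "e \<bullet> c = 0"
        using C(1) c by (simp add: e_def inner_diff_left inner_sum_left)
      then show ?thesis by (simp add: orthogonal_def)
    qed
    then have "orthogonal e e"
      by (intro orthogonal_to_span[of e C]) (simp_all add: C)
    then show ?thesis by (simp add: e_def orthogonal_self)
  qed
  then show ?thesis using that C(1) by blast
qed

text \<open>The coefficients range over a box, so the set is a Minkowski sum of compact segments,
  one for each vector.\<close>

lemma compact_bounded_combinations:
  fixes C :: "'a::real_normed_vector set"
  assumes "finite C"
  shows "compact {\<Sum>b\<in>C. f b *\<^sub>R b | f. \<forall>b\<in>C. \<bar>f b\<bar> \<le> (K b :: real)}"
  using assms
proof (induction C)
  case empty
  then show ?case by simp
next
  case (insert c C)
  let ?S = "{\<Sum>b\<in>C. f b *\<^sub>R b | f. \<forall>b\<in>C. \<bar>f b\<bar> \<le> K b}"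
  have "compact ((\<lambda>t. t *\<^sub>R c) ` {- K c..K c})"
    by (intro compact_continuous_image continuous_intros compact_Icc)
  then have "compact {x + y | x y. x \<in> (\<lambda>t. t *\<^sub>R c) ` {- K c..K c} \<and> y \<in> ?S}"
    using insert.IH compact_sums by blast
  moreover have "{x + y | x y. x \<in> (\<lambda>t. t *\<^sub>R c) ` {- K c..K c} \<and> y \<in> ?S}
      = {\<Sum>b\<in>insert c C. f b *\<^sub>R b | f. \<forall>b\<in>insert c C. \<bar>f b\<bar> \<le> K b}" (is "?A = ?B")
  proof (intro equalityI subsetI)
    fix z assume "z \<in> ?A"
    then obtain t f where tf: "t \<in> {- K c..K c}" "\<forall>b\<in>C. \<bar>f b\<bar> \<le> K b"
      "z = t *\<^sub>R c + (\<Sum>b\<in>C. f b *\<^sub>R b)" by auto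
    have "(\<Sum>b\<in>C. (f(c := t)) b *\<^sub>R b) = (\<Sum>b\<in>C. f b *\<^sub>R b)"
      using insert.hyps by (intro sum.cong) auto
    then have "z = (\<Sum>b\<in>insert c C. (f(c := t)) b *\<^sub>R b)"
      using tf(3) insert.hyps by simp
    moreover have "\<forall>b\<in>insert c C. \<bar>(f(c := t)) b\<bar> \<le> K b"
      using tf by auto
    ultimately show "z \<in> ?B" by blast
  next
    fix z assume "z \<in> ?B"
    then obtain f where f: "\<forall>b\<in>insert c C. \<bar>f b\<bar> \<le> K b" "z = (\<Sum>b\<in>insert c C. f b *\<^sub>R b)"
      by auto
    have "z = f c *\<^sub>R c + (\<Sum>b\<in>C. f b *\<^sub>R b)" "f c \<in> {- K c..K c}"
      using f insert.hyps by auto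
    then show "z \<in> ?A" using f(1) by blast
  qed
  ultimately show ?case by simp
qed

text \<open>Bolzano-Weierstrass: Cauchy-Schwarz bounds every coordinate, which places the sequence
  in a compact set of combinations.\<close>

lemma finite_span_bounded_subsequence:
  fixes B :: "'a::real_inner set" and X :: "nat \<Rightarrow> 'a"
  assumes "finite B" "span B = UNIV" and bd: "\<And>k. norm (X k) \<le> M"
  obtains l r where "strict_mono r" "(\<lambda>k. X (r k)) \<longlonglongrightarrow> l"
proof -
  obtain C :: "'a set" where C: "finite C" "\<And>x. x = (\<Sum>b\<in>C. ((x \<bullet> b) / (b \<bullet> b)) *\<^sub>R b)"
    using finite_span_orthogonal_expansion[OF assms(1,2)] by blast
  let ?S = "{\<Sum>b\<in>C. f b *\<^sub>R b | f. \<forall>b\<in>C. \<bar>f b\<bar> \<le> M * norm b / (b \<bullet> b)}"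
  have "\<bar>X k \<bullet> b / (b \<bullet> b)\<bar> \<le> M * norm b / (b \<bullet> b)" for k b
  proof -
    have "\<bar>X k \<bullet> b\<bar> \<le> M * norm b"
      using Cauchy_Schwarz_ineq2[of "X k" b] mult_right_mono[OF bd[of k], of "norm b"] by simp
    then show ?thesis by (simp add: divide_right_mono)
  qed
  then have "X k \<in> ?S" for k
    by (intro CollectI exI[of _ "\<lambda>b. X k \<bullet> b / (b \<bullet> b)"] conjI C(2) ballI)
  moreover have "seq_compact ?S"
    by (intro compact_imp_seq_compact compact_bounded_combinations C(1))
  ultimately obtain l r where "strict_mono (r :: nat \<Rightarrow> nat)" "(X \<circ> r) \<longlonglongrightarrow> l"
    by (metis (no_types, lifting) seq_compactE)
  then show ?thesis using that[of r l] by (simp add: o_def)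
qed

text \<open>\<open>adjoint\<close> is defined by choice, so its characteristic identity becomes
  available once some adjoint is exhibited; the expansion of \<open>x\<close> provides one
  explicitly.\<close>

lemma finite_span_adjoint_works:
  fixes L :: "'a::real_inner \<Rightarrow> 'b::real_inner" and B :: "'a set"
  assumes "finite B" "span B = UNIV" and L: "linear L"
  shows "L x \<bullet> z = x \<bullet> adjoint L z"
proof -
  obtain C :: "'a set" where C: "finite C" "\<And>x. x = (\<Sum>b\<in>C. ((x \<bullet> b) / (b \<bullet> b)) *\<^sub>R b)"
    using finite_span_orthogonal_expansion[OF assms(1,2)] by blast
  have *: "L x \<bullet> z = x \<bullet> (\<Sum>b\<in>C. ((L b \<bullet> z) / (b \<bullet> b)) *\<^sub>R b)" for x z
  proof -
    have "L x \<bullet> z = L (\<Sum>b\<in>C. ((x \<bullet> b) / (b \<bullet> b)) *\<^sub>R b) \<bullet> z"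
      by (simp flip: C(2))
    also have "\<dots> = x \<bullet> (\<Sum>b\<in>C. ((L b \<bullet> z) / (b \<bullet> b)) *\<^sub>R b)"
      by (simp add: linear_sum[OF L] linear_cmul[OF L] inner_sum_left inner_sum_right ac_simps)
    finally show ?thesis .
  qed
  have "adjoint L = (\<lambda>z. \<Sum>b\<in>C. ((L b \<bullet> z) / (b \<bullet> b)) *\<^sub>R b)"
    by (intro adjoint_unique allI *)
  then show ?thesis by (metis *)
qed

lemma finite_span_bounded_linear:
  fixes L :: "'a::real_inner \<Rightarrow> 'b::real_normed_vector" and B :: "'a set"
  assumes "finite B" "span B = UNIV" and L: "linear L"
  shows "bounded_linear L"
proof -
  obtain C :: "'a set" where C: "finite C" "\<And>x. x = (\<Sum>b\<in>C. ((x \<bullet> b) / (b \<bullet> b)) *\<^sub>R b)"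
    using finite_span_orthogonal_expansion[OF assms(1,2)] by blast
  show ?thesis
  proof (rule bounded_linear_intro)
    show "norm (L x) \<le> norm x * (\<Sum>b\<in>C. norm b / (b \<bullet> b) * norm (L b))" for x
    proof -
      have "L x = L (\<Sum>b\<in>C. ((x \<bullet> b) / (b \<bullet> b)) *\<^sub>R b)"
        by (simp flip: C(2))
      also have "\<dots> = (\<Sum>b\<in>C. ((x \<bullet> b) / (b \<bullet> b)) *\<^sub>R L b)"
        by (simp add: linear_sum[OF L] linear_cmul[OF L])
      also have "norm \<dots> \<le> (\<Sum>b\<in>C. norm x * (norm b / (b \<bullet> b) * norm (L b)))"
      proof (rule sum_norm_le)
        fix b
        have "\<bar>x \<bullet> b\<bar> / (b \<bullet> b) * norm (L b) \<le> norm x * norm b / (b \<bullet> b) * norm (L b)"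
          by (intro mult_right_mono divide_right_mono Cauchy_Schwarz_ineq2) auto
        then show "norm (((x \<bullet> b) / (b \<bullet> b)) *\<^sub>R L b) \<le> norm x * (norm b / (b \<bullet> b) * norm (L b))"
          by simp
      qed
      finally show ?thesis by (simp add: sum_distrib_left)
    qed
  qed (use L in \<open>simp_all add: linear_add linear_cmul\<close>)
qed

text \<open>The square of \<open>norm (Ls z)\<close> equals \<open>L (Ls z) \<bullet> z\<close>, so
  one factor cancels. This carries the step-size condition on \<open>onorm L\<close> over to the
  adjoint.\<close>

lemma adjoint_bound:
  fixes L :: "'a::real_inner \<Rightarrow> 'b::real_inner"
  assumes L: "bounded_linear L" and adj: "\<And>x z. L x \<bullet> z = x \<bullet> Ls z"
  shows "norm (Ls z) \<le> onorm L * norm z"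
proof (cases "Ls z = 0")
  case True
  then show ?thesis using onorm_pos_le[OF L] by simp
next
  case False
  have "norm (Ls z) * norm (Ls z) = L (Ls z) \<bullet> z"
    by (simp add: adj power2_norm_eq_inner[symmetric] power2_eq_square)
  also have "\<dots> \<le> norm (L (Ls z)) * norm z"
    by (rule norm_cauchy_schwarz)
  also have "\<dots> \<le> onorm L * norm (Ls z) * norm z"
    by (intro mult_right_mono onorm[OF L]) auto
  finally show ?thesis using False by (simp add: ac_simps)
qed

lemma adjoint_linear_of_inner:
  fixes L :: "'a::real_inner \<Rightarrow> 'b::real_inner"
  assumes adj: "\<And>x z. L x \<bullet> z = x \<bullet> Ls z"
  shows "linear Ls"
proof (rule linearI)
  show "Ls (u + v) = Ls u + Ls v" for u v
    by (rule vector_eq_ldot[THEN iffD1]) (simp add: inner_add_right flip: adj)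
  show "Ls (c *\<^sub>R v) = c *\<^sub>R Ls v" for c v
    by (rule vector_eq_ldot[THEN iffD1]) (simp flip: adj)
qed

section \<open>Subdifferentials, conjugates and proximal points\<close>

lemma subdifferential_finite:
  assumes "proper_fun G" "g \<in> subdifferential G u"
  obtains r where "G u = ereal r"
proof -
  obtain x0 where "G x0 \<noteq> \<infinity>" using assms(1) by (auto simp: proper_fun_def)
  moreover have "G u + ereal (g \<bullet> (x0 - u)) \<le> G x0"
    using assms(2) by (auto simp: subdifferential_def)
  ultimately have "G u \<noteq> \<infinity>" by auto
  then show ?thesis using assms(1) that by (cases "G u") (auto simp: proper_fun_def)
qed

lemma subdifferentialD:
  "g \<in> subdifferential G u \<Longrightarrow> G u + ereal (g \<bullet> (z - u)) \<le> G z"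
  by (simp add: subdifferential_def)

text \<open>Add the two subgradient inequalities, each taken at the base point of the other; the
  function values cancel because both are finite.\<close>

lemma subdifferential_monotone:
  assumes "proper_fun G" "g \<in> subdifferential G u" "h \<in> subdifferential G w"
  shows "0 \<le> (g - h) \<bullet> (u - w)"
proof -
  obtain a b where ab: "G u = ereal a" "G w = ereal b"
    using subdifferential_finite assms by metis
  show ?thesis
    using subdifferentialD[OF assms(2), of w] subdifferentialD[OF assms(3), of u]
    by (simp add: ab inner_diff_left inner_diff_right)
qed

lemma lsc_le_of_tendsto:
  assumes "lsc G" and X: "X \<longlonglongrightarrow> u" and c: "c \<longlonglongrightarrow> (d::real)"
    and le: "\<And>k. G (X k) \<le> ereal (c k)"
  shows "G u \<le> ereal d"
proof (rule ccontr)
  assume "\<not> G u \<le> ereal d"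
  then obtain m where m: "ereal d < m" "m < G u" using dense not_le by metis
  have "G u \<le> Liminf (at u) G" using assms(1) by (simp add: lsc_def)
  then have "eventually (\<lambda>z. m < G z) (at u)" using m(2) by (simp add: le_Liminf_iff)
  \<comment> \<open>The filter \<open>at u\<close> leaves out \<open>u\<close>, but some
    \<open>X k\<close> may equal \<open>u\<close>; the bound \<open>m < G u\<close> covers that
    point.\<close>
  then have "eventually (\<lambda>z. m < G z) (nhds u)"
    using m(2) by (auto simp: eventually_at_filter elim: eventually_mono)
  then have "eventually (\<lambda>k. m < G (X k)) sequentially"
    by (rule eventually_compose_filterlim[OF _ X])
  moreover have "eventually (\<lambda>k. ereal (c k) < m) sequentially"
    using m(1) c by (intro order_tendstoD(2)[where y="ereal d"]) auto
  ultimately have "eventually (\<lambda>k. False) sequentially"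
    by eventually_elim (use le in \<open>meson leD less_trans order_less_le_trans\<close>)
  then show False by simp
qed

text \<open>For fixed \<open>z\<close> with \<open>G z\<close> finite, the subgradient inequality
  bounds \<open>G (X k)\<close> above by a convergent real sequence, and lower semicontinuity
  carries the bound to the limit.\<close>

lemma subdifferential_closed:
  assumes "proper_fun G" "lsc G" and u: "X \<longlonglongrightarrow> u" and g: "Y \<longlonglongrightarrow> g"
    and sub: "\<And>k. Y k \<in> subdifferential G (X k)"
  shows "g \<in> subdifferential G u"
proof -
  have "G u + ereal (g \<bullet> (z - u)) \<le> G z" for z
  proof (cases "G z")
    case (real r)
    have "G (X k) \<le> ereal (r - Y k \<bullet> (z - X k))" for k
      using subdifferentialD[OF sub, of k z] real by (cases "G (X k)") auto
    moreover have "(\<lambda>k. r - Y k \<bullet> (z - X k)) \<longlonglongrightarrow> r - g \<bullet> (z - u)"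
      by (intro tendsto_intros u g)
    ultimately have "G u \<le> ereal (r - g \<bullet> (z - u))"
      using lsc_le_of_tendsto assms(2) u by blast
    then show ?thesis using real by (cases "G u") auto
  qed (use assms(1) in \<open>auto simp: proper_fun_def\<close>)
  then show ?thesis by (simp add: subdifferential_def)
qed

lemma conjugate_ge: "ereal (u \<bullet> z) - G u \<le> conjugate G z"
  unfolding conjugate_def by (rule SUP_upper) simp

lemma conjugate_at_subgradient:
  assumes "proper_fun G" "g \<in> subdifferential G u"
  shows "conjugate G g = ereal (u \<bullet> g) - G u"
proof (rule antisym)
  obtain r where r: "G u = ereal r" using subdifferential_finite assms by metis
  show "conjugate G g \<le> ereal (u \<bullet> g) - G u"
    unfolding conjugate_def
  proof (rule SUP_least)
    fix z
    show "ereal (z \<bullet> g) - G z \<le> ereal (u \<bullet> g) - G u"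
      using subdifferentialD[OF assms(2), of z] assms(1) r
      by (cases "G z") (auto simp: proper_fun_def inner_diff_right inner_commute)
  qed
qed (rule conjugate_ge)

text \<open>Combine Fenchel's equality at \<open>g\<close> with Fenchel's inequality at
  \<open>z\<close>, both for the same primal point \<open>u\<close>.\<close>

lemma subgradient_conjugate:
  assumes "proper_fun G" "g \<in> subdifferential G u"
  shows "u \<in> subdifferential (conjugate G) g"
proof -
  obtain r where r: "G u = ereal r" using subdifferential_finite assms by metis
  have "conjugate G g + ereal (u \<bullet> (z - g)) \<le> conjugate G z" for z
    using conjugate_ge[of u z G] conjugate_at_subgradient[OF assms] r
    by (simp add: inner_diff_right)
  then show ?thesis by (simp add: subdifferential_def)
qed

lemma proper_conjugate:
  assumes "proper_fun G" "g \<in> subdifferential G u"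
  shows "proper_fun (conjugate G)"
proof -
  obtain r where r: "G u = ereal r" using subdifferential_finite assms by metis
  have "conjugate G z \<noteq> -\<infinity>" for z
    using conjugate_ge[of u z G] r by auto
  moreover have "conjugate G g \<noteq> \<infinity>"
    using conjugate_at_subgradient[OF assms] r by simp
  ultimately show ?thesis by (auto simp: proper_fun_def)
qed

lemma convex_conjugate:
  assumes "proper_fun G"
  shows "convex_fun (conjugate G)"
  unfolding convex_fun_def
proof (intro allI impI)
  fix y z and a b :: real
  assume ab: "0 \<le> a" "0 \<le> b" "a + b = 1"
  show "conjugate G (a *\<^sub>R y + b *\<^sub>R z) \<le> ereal a * conjugate G y + ereal b * conjugate G z"
    unfolding conjugate_def[of G "a *\<^sub>R y + b *\<^sub>R z"]
  proof (rule SUP_least)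
    fix w
    show "ereal (w \<bullet> (a *\<^sub>R y + b *\<^sub>R z)) - G w \<le> ereal a * conjugate G y + ereal b * conjugate G z"
    proof (cases "G w")
      case (real r)
      \<comment> \<open>The last summand vanishes because \<open>a + b = 1\<close>; including it
        makes the identity pure ring algebra.\<close>
      have "ereal (w \<bullet> (a *\<^sub>R y + b *\<^sub>R z)) - G w
          = ereal (a * (w \<bullet> y - r) + b * (w \<bullet> z - r) + (a + b - 1) * r)"
        using real by (simp add: inner_add_right algebra_simps)
      also have "\<dots> = ereal a * (ereal (w \<bullet> y) - G w) + ereal b * (ereal (w \<bullet> z) - G w)"
        using ab real by simp
      also have "\<dots> \<le> ereal a * conjugate G y + ereal b * conjugate G z"
        using ab by (intro add_mono ereal_mult_left_mono conjugate_ge) auto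
      finally show ?thesis .
    qed (use assms in \<open>auto simp: proper_fun_def\<close>)
  qed
qed

text \<open>A conjugate is a supremum of continuous affine functions, and one that exceeds
  \<open>c\<close> at a point still exceeds \<open>c\<close> nearby.\<close>

lemma lsc_conjugate:
  assumes "proper_fun G"
  shows "lsc (conjugate G)"
  unfolding lsc_def le_Liminf_iff
proof (intro allI impI)
  fix z c assume "c < conjugate G z"
  then obtain w where w: "c < ereal (w \<bullet> z) - G w"
    by (auto simp: conjugate_def less_SUP_iff)
  show "eventually (\<lambda>z. c < conjugate G z) (at z)"
  proof (cases "G w")
    case (real r)
    have "((\<lambda>z. ereal (w \<bullet> z - r)) \<longlongrightarrow> ereal (w \<bullet> z - r)) (at z)"
      by (intro tendsto_intros)
    then have "eventually (\<lambda>z. c < ereal (w \<bullet> z - r)) (at z)"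
      using w real by (intro order_tendstoD(1)) auto
    then show ?thesis
      by (rule eventually_mono) (use conjugate_ge[of w _ G] real in \<open>auto intro: less_le_trans\<close>)
  qed (use w assms in \<open>auto simp: proper_fun_def\<close>)
qed

text \<open>Since \<open>prox\<close> chooses a minimizer, one must be shown to exist. Direct
  method: the subgradient gives an affine minorant, the quadratic term dominates it, so a minimizing
  sequence is bounded, and lower semicontinuity makes its cluster point a minimizer.\<close>

lemma prox_is_arg_min:
  fixes G :: "'a::real_inner \<Rightarrow> ereal" and B :: "'a set"
  assumes fd: "finite B" "span B = UNIV"
    and G: "proper_fun G" "lsc G" and g: "g \<in> subdifferential G u" and t: "t > 0"
  shows "is_arg_min (\<lambda>z. ereal t * G z + ereal ((norm (v - z))\<^sup>2 / 2)) (\<lambda>_. True)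
           (prox (\<lambda>z. ereal t * G z) v)"
proof -
  define D where "D = {z. G z \<noteq> \<infinity>}"
  define h where "h z = real_of_ereal (G z)" for z
  define f where "f z = t * h z + (norm (v - z))\<^sup>2 / 2" for z
  have Gh: "G z = ereal (h z)" if "z \<in> D" for z
    using that G(1) by (cases "G z") (auto simp: D_def h_def proper_fun_def)
  obtain a where a: "G u = ereal a" using subdifferential_finite G(1) g by metis
  have uD: "u \<in> D" using a by (simp add: D_def)
  \<comment> \<open>The value at \<open>v\<close> of the affine minorant of \<open>t * G\<close>
    supplied by \<open>g\<close>.\<close>
  define e where "e = t * a + t * (g \<bullet> (v - u))"
  have fe: "f z \<ge> e - t * norm g * norm (v - z) + (norm (v - z))\<^sup>2 / 2" if "z \<in> D" for z
  proof -
    have "a + g \<bullet> (z - u) \<le> h z"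
      using subdifferentialD[OF g, of z] Gh[OF that] a by simp
    moreover have "g \<bullet> (z - u) = g \<bullet> (v - u) - g \<bullet> (v - z)"
      by (simp add: inner_diff_right)
    moreover have "g \<bullet> (v - z) \<le> norm g * norm (v - z)" by (rule norm_cauchy_schwarz)
    ultimately have "a + g \<bullet> (v - u) - norm g * norm (v - z) \<le> h z" by linarith
    from mult_left_mono[OF this, of t] t show ?thesis
      by (simp add: f_def e_def algebra_simps)
  qed
  \<comment> \<open>Completing the square in \<open>norm (v - z)\<close> makes the bound independent
    of \<open>z\<close>.\<close>
  have lower: "f z \<ge> e - (t * norm g)\<^sup>2 / 2" if "z \<in> D" for z
    using fe[OF that] zero_le_power2[of "norm (v - z) - t * norm g"]
    by (simp add: power2_diff algebra_simps)
  define m where "m = Inf (f ` D)"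
  have bdd: "bdd_below (f ` D)" using lower by (auto intro!: bdd_belowI)
  have m_le: "m \<le> f z" if "z \<in> D" for z
    unfolding m_def using that bdd by (intro cInf_lower) auto
  have "\<exists>z\<in>D. f z < m + 1 / real (Suc k)" for k
  proof -
    have "Inf (f ` D) < m + 1 / real (Suc k)" by (simp add: m_def)
    then show ?thesis using bdd uD by (subst (asm) cInf_less_iff) auto
  qed
  then obtain Z where Z: "\<And>k. Z k \<in> D" "\<And>k. f (Z k) < m + 1 / real (Suc k)" by metis
  have "norm (Z k) \<le> norm v + (2 * t * norm g + 2 * \<bar>m + 1 - e\<bar> + 2)" for k
  proof -
    define \<rho> where "\<rho> = norm (v - Z k)"
    define n where "n = t * norm g"
    define q where "q = \<bar>m + 1 - e\<bar>"
    have n: "n \<ge> 0" and \<rho>: "\<rho> \<ge> 0" and q: "q \<ge> 0" using t by (auto simp: n_def \<rho>_def q_def)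
    have "1 / real (Suc k) \<le> 1" by simp
    then have *: "\<rho>\<^sup>2 / 2 - n * \<rho> \<le> q"
      using fe[OF Z(1), of k] Z(2)[of k] unfolding \<rho>_def n_def q_def by linarith
    \<comment> \<open>Otherwise \<open>\<rho> / 2 - n\<close> exceeds \<open>q + 1\<close> and
      \<open>\<rho>\<close> exceeds 1, so their product violates the bound just obtained.\<close>
    have "\<rho> \<le> 2 * n + 2 * q + 2"
    proof (rule ccontr)
      assume "\<not> ?thesis"
      then have "1 * (q + 1) \<le> \<rho> * (\<rho> / 2 - n)" using n q by (intro mult_mono) auto
      also have "\<dots> = \<rho>\<^sup>2 / 2 - n * \<rho>" by (simp add: power2_eq_square algebra_simps)
      finally show False using * by simp
    qed
    moreover have "norm (Z k) \<le> norm v + \<rho>"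
      unfolding \<rho>_def by (metis norm_triangle_sub norm_minus_commute)
    ultimately show ?thesis by (simp add: n_def q_def)
  qed
  then obtain w r where r: "strict_mono (r :: nat \<Rightarrow> nat)" and w: "(\<lambda>k. Z (r k)) \<longlonglongrightarrow> w"
    using finite_span_bounded_subsequence[OF fd] by metis
  \<comment> \<open>With \<open>G\<close> isolated, the rest is a convergent real sequence, so lower
    semicontinuity of \<open>G\<close> alone suffices.\<close>
  have "G (Z (r k)) \<le> ereal ((m + 1 / real (Suc (r k)) - (norm (v - Z (r k)))\<^sup>2 / 2) / t)" for k
    using Z(2)[of "r k"] t by (simp add: Gh[OF Z(1)] f_def pos_le_divide_eq mult.commute)
  moreover have "(\<lambda>k. 1 / real (Suc (r k))) \<longlonglongrightarrow> 0"
    using LIMSEQ_subseq_LIMSEQ[OF LIMSEQ_inverse_real_of_nat r]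
    by (simp add: o_def inverse_eq_divide)
  then have "(\<lambda>k. (m + 1 / real (Suc (r k)) - (norm (v - Z (r k)))\<^sup>2 / 2) / t)
      \<longlonglongrightarrow> (m + 0 - (norm (v - w))\<^sup>2 / 2) / t"
    using t by (intro tendsto_intros w) auto
  ultimately have Gw: "G w \<le> ereal ((m + 0 - (norm (v - w))\<^sup>2 / 2) / t)"
    using lsc_le_of_tendsto[OF G(2) w] by blast
  then have wD: "w \<in> D" by (auto simp: D_def)
  have fw: "f w \<le> m" using Gw t by (simp add: Gh[OF wD] f_def field_simps)
  have "is_arg_min (\<lambda>z. ereal t * G z + ereal ((norm (v - z))\<^sup>2 / 2)) (\<lambda>_. True) w"
  proof -
    have "ereal t * G w + ereal ((norm (v - w))\<^sup>2 / 2)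
        \<le> ereal t * G z + ereal ((norm (v - z))\<^sup>2 / 2)" for z
    proof (cases "z \<in> D")
      case True
      then show ?thesis using fw m_le[OF True] by (simp add: Gh wD f_def)
    next
      case False
      then show ?thesis using t by (simp add: D_def)
    qed
    then show ?thesis by (auto simp: is_arg_min_def not_less)
  qed
  then show ?thesis unfolding prox_def arg_min_def by (rule someI)
qed

lemma norm_diff_scaleR_squared:
  fixes a d :: "'a::real_inner"
  shows "(norm (a - l *\<^sub>R d))\<^sup>2 = (norm a)\<^sup>2 - 2 * l * (a \<bullet> d) + l\<^sup>2 * (norm d)\<^sup>2"
  unfolding power2_norm_eq_inner
  by (simp add: inner_diff_left inner_diff_right inner_commute[of d a] power2_eq_square[of l] algebra_simps)

text \<open>First-order optimality without derivatives: compare the minimizer \<open>w\<close> with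
  the point at fraction \<open>l\<close> of the way to \<open>z\<close>, use convexity, divide by
  \<open>l\<close> and let \<open>l\<close> tend to 0 from the right; the quadratic remainder
  vanishes.\<close>

lemma prox_subgradient:
  fixes G :: "'a::real_inner \<Rightarrow> ereal" and B :: "'a set"
  assumes fd: "finite B" "span B = UNIV"
    and G: "proper_fun G" "convex_fun G" "lsc G"
    and g: "g \<in> subdifferential G u" and t: "t > 0"
    and w: "w = prox (\<lambda>z. ereal t * G z) v"
  shows "(1 / t) *\<^sub>R (v - w) \<in> subdifferential G w"
proof -
  obtain a where a: "G u = ereal a" using subdifferential_finite G(1) g by metis
  have min: "ereal t * G w + ereal ((norm (v - w))\<^sup>2 / 2)
      \<le> ereal t * G z + ereal ((norm (v - z))\<^sup>2 / 2)" for z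
    using prox_is_arg_min[OF fd G(1,3) g t, of v] by (auto simp: is_arg_min_def not_less w)
  obtain b where b: "G w = ereal b"
    using min[of u] a t G(1) by (cases "G w") (auto simp: proper_fun_def)
  have "G w + ereal (((1 / t) *\<^sub>R (v - w)) \<bullet> (z - w)) \<le> G z" for z
  proof (cases "G z")
    case (real c)
    have le: "t * b + (v - w) \<bullet> (z - w) \<le> t * c + l * (norm (z - w))\<^sup>2 / 2"
      if l: "0 < l" "l < 1" for l
    proof -
      define q where "q = (1 - l) *\<^sub>R w + l *\<^sub>R z"
      have Gq: "G q \<le> ereal ((1 - l) * b + l * c)"
        using G(2)[unfolded convex_fun_def, rule_format, of "1 - l" l w z] l b real
        by (simp add: q_def)
      then obtain d where d: "G q = ereal d"
        using G(1) by (cases "G q") (auto simp: proper_fun_def)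
      have "t * b + (norm (v - w))\<^sup>2 / 2 \<le> t * d + (norm (v - q))\<^sup>2 / 2"
        using min[of q] b d by simp
      moreover have "t * d \<le> t * ((1 - l) * b + l * c)"
        using Gq d t by simp
      moreover have "v - q = (v - w) - l *\<^sub>R (z - w)"
        by (simp add: q_def algebra_simps)
      then have "(norm (v - q))\<^sup>2
          = (norm (v - w))\<^sup>2 - 2 * l * ((v - w) \<bullet> (z - w)) + l\<^sup>2 * (norm (z - w))\<^sup>2"
        by (simp only: norm_diff_scaleR_squared)
      ultimately have "l * (t * b + (v - w) \<bullet> (z - w)) \<le> l * (t * c + l * (norm (z - w))\<^sup>2 / 2)"
        by (simp add: algebra_simps power2_eq_square)
      then show ?thesis using l by simp
    qed
    have "t * b + (v - w) \<bullet> (z - w) \<le> t * c + 0 * (norm (z - w))\<^sup>2 / 2"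
    proof (rule tendsto_lowerbound)
      show "((\<lambda>l. t * c + l * (norm (z - w))\<^sup>2 / 2) \<longlongrightarrow> t * c + 0 * (norm (z - w))\<^sup>2 / 2) (at_right 0)"
        by (intro tendsto_intros) simp
      show "eventually (\<lambda>l. t * b + (v - w) \<bullet> (z - w) \<le> t * c + l * (norm (z - w))\<^sup>2 / 2) (at_right 0)"
        unfolding eventually_at_right_field using le by (intro exI[of _ 1]) auto
    qed simp
    then have "b + (v - w) \<bullet> (z - w) / t \<le> c" using t by (simp add: field_simps)
    then show ?thesis using b real by simp
  qed (use G(1) in \<open>auto simp: proper_fun_def\<close>)
  then show ?thesis by (simp add: subdifferential_def)
qed

text \<open>Minty's argument instead of biconjugation: with \<open>w = prox G (u + y)\<close>, the subgradient
  \<open>u + y - w\<close> of \<open>G\<close> at \<open>w\<close> and the monotonicity of the conjugate's subdifferential force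
  \<open>w = u\<close>.\<close>

lemma conjugate_subgradient:
  fixes G :: "'a::real_inner \<Rightarrow> ereal" and B :: "'a set"
  assumes fd: "finite B" "span B = UNIV"
    and G: "proper_fun G" "convex_fun G" "lsc G"
    and g: "g \<in> subdifferential G u0" and u: "u \<in> subdifferential (conjugate G) y"
  shows "y \<in> subdifferential G u"
proof -
  define w where "w = prox (\<lambda>z. ereal 1 * G z) (u + y)"
  have w: "u + y - w \<in> subdifferential G w"
    using prox_subgradient[OF fd G g zero_less_one w_def] by simp
  have "0 \<le> (u - w) \<bullet> (y - (u + y - w))"
    by (rule subdifferential_monotone[OF proper_conjugate[OF G(1) g] u
          subgradient_conjugate[OF G(1) w]])
  moreover have "y - (u + y - w) = - (u - w)" by simp
  ultimately have "(u - w) \<bullet> (u - w) \<le> 0" by (metis inner_minus_right neg_0_le_iff_le)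
  then have "u = w" using inner_ge_zero[of "u - w"] by (metis antisym eq_iff_diff_eq_0 inner_eq_zero_iff)
  then show ?thesis using w by simp
qed

section \<open>Smooth convex functions\<close>

lemma GDERIV_along_line:
  assumes "GDERIV F (a + t *\<^sub>R d) :> g"
  shows "((\<lambda>t. F (a + t *\<^sub>R d)) has_real_derivative d \<bullet> g) (at t)"
proof -
  have "((\<lambda>t. a + t *\<^sub>R d) has_derivative (\<lambda>h. h *\<^sub>R d)) (at t)"
    by (auto intro!: derivative_eq_intros)
  from has_derivative_compose[OF this assms[unfolded gderiv_def]] show ?thesis
    by (simp add: has_field_derivative_def mult_commute_abs)
qed

text \<open>Restricting \<open>F\<close> to the line through \<open>a\<close> and \<open>z\<close>
  reduces this to the tangent inequality for convex functions of one real variable.\<close>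

lemma convex_gradient_ineq:
  fixes F :: "'a::real_inner \<Rightarrow> real"
  assumes "convex_on UNIV F" "GDERIV F a :> g"
  shows "F a + g \<bullet> (z - a) \<le> F z"
proof -
  define d where "d = z - a"
  have "convex_on UNIV (\<lambda>t. F (a + t *\<^sub>R d))"
  proof (rule convex_onI)
    fix t x y :: real assume t: "0 < t" "t < 1"
    have "a + ((1 - t) *\<^sub>R x + t *\<^sub>R y) *\<^sub>R d = (1 - t) *\<^sub>R (a + x *\<^sub>R d) + t *\<^sub>R (a + y *\<^sub>R d)"
      by (simp add: algebra_simps)
    then show "F (a + ((1 - t) *\<^sub>R x + t *\<^sub>R y) *\<^sub>R d)
        \<le> (1 - t) * F (a + x *\<^sub>R d) + t * F (a + y *\<^sub>R d)"
      using convex_onD[OF assms(1), of t "a + x *\<^sub>R d" "a + y *\<^sub>R d"] t by simp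
  qed simp
  moreover have "((\<lambda>t. F (a + t *\<^sub>R d)) has_real_derivative d \<bullet> g) (at 0)"
    using GDERIV_along_line[of F a 0 d g] assms(2) by simp
  ultimately have "F (a + 1 *\<^sub>R d) - F (a + 0 *\<^sub>R d) \<ge> (d \<bullet> g) * (1 - 0)"
    by (intro convex_on_imp_above_tangent[where A=UNIV]) auto
  then show ?thesis by (simp add: d_def inner_commute)
qed

text \<open>The difference \<open>f\<close> between \<open>F\<close> and its quadratic upper model
  is nonincreasing along the segment, since the Lipschitz bound makes its derivative
  nonpositive.\<close>

lemma lipschitz_gradient_descent:
  fixes F :: "'a::real_inner \<Rightarrow> real"
  assumes grad: "\<And>z. GDERIV F z :> gradF z" and lip: "\<nu>-lipschitz_on UNIV gradF"
  shows "F (a + d) \<le> F a + gradF a \<bullet> d + \<nu> / 2 * (norm d)\<^sup>2"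
proof -
  define f where "f t = F (a + t *\<^sub>R d) - t * (gradF a \<bullet> d) - \<nu> / 2 * t\<^sup>2 * (norm d)\<^sup>2" for t
  have "f 0 \<ge> f 1"
  proof (rule DERIV_nonpos_imp_nonincreasing[of 0 1 f])
    fix t :: real assume t: "0 \<le> t" "t \<le> 1"
    let ?D = "d \<bullet> gradF (a + t *\<^sub>R d) - gradF a \<bullet> d - \<nu> * t * (norm d)\<^sup>2"
    have "(f has_real_derivative ?D) (at t)"
      unfolding f_def by (auto intro!: derivative_eq_intros GDERIV_along_line grad)
    moreover have "?D \<le> 0"
    proof -
      have "d \<bullet> gradF (a + t *\<^sub>R d) - gradF a \<bullet> d = (gradF (a + t *\<^sub>R d) - gradF a) \<bullet> d"
        by (metis inner_commute inner_diff_left)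
      also have "\<dots> \<le> norm (gradF (a + t *\<^sub>R d) - gradF a) * norm d"
        by (rule norm_cauchy_schwarz)
      also have "\<dots> \<le> \<nu> * (t * norm d) * norm d"
        using lipschitz_onD[OF lip, of "a + t *\<^sub>R d" a] t
        by (intro mult_right_mono) (auto simp: dist_norm)
      finally show ?thesis by (simp add: power2_eq_square)
    qed
    ultimately show "\<exists>y. DERIV f t :> y \<and> y \<le> 0" by blast
  qed simp
  then show ?thesis by (simp add: f_def)
qed

text \<open>Baillon-Haddad inequality: a sharpened tangent inequality is proved first, then added to
  itself with \<open>a\<close> and \<open>b\<close> exchanged.\<close>

lemma lipschitz_gradient_cocoercive:
  fixes F :: "'a::real_inner \<Rightarrow> real"
  assumes conv: "convex_on UNIV F" and grad: "\<And>z. GDERIV F z :> gradF z"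
    and lip: "\<nu>-lipschitz_on UNIV gradF" and nu: "\<nu> > 0"
  shows "(norm (gradF a - gradF b))\<^sup>2 / \<nu> \<le> (gradF a - gradF b) \<bullet> (a - b)"
proof -
  have *: "F a + gradF a \<bullet> (b - a) + (norm (gradF b - gradF a))\<^sup>2 / (2 * \<nu>) \<le> F b" for a b
  proof -
    define e where "e = gradF b - gradF a"
    \<comment> \<open>This displacement minimizes
      \<open>e \<bullet> d + \<nu> / 2 * (norm d)\<^sup>2\<close>, the gap between the tangent at
      \<open>a\<close> and the quadratic model at \<open>b\<close>, up to a constant.\<close>
    define d where "d = - (1 / \<nu>) *\<^sub>R e"
    have "F a + gradF a \<bullet> (b + d - a) \<le> F (b + d)"
      by (rule convex_gradient_ineq[OF conv grad])
    also have "\<dots> \<le> F b + gradF b \<bullet> d + \<nu> / 2 * (norm d)\<^sup>2"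
      by (rule lipschitz_gradient_descent[OF grad lip])
    finally have "F a + gradF a \<bullet> (b - a) \<le> F b + e \<bullet> d + \<nu> / 2 * (norm d)\<^sup>2"
      by (simp add: e_def inner_diff_left inner_diff_right inner_add_right)
    moreover have "e \<bullet> d = - ((norm e)\<^sup>2 / \<nu>)" "\<nu> / 2 * (norm d)\<^sup>2 = (norm e)\<^sup>2 / (2 * \<nu>)"
      using nu by (simp_all add: d_def dot_square_norm power2_eq_square)
    moreover have "(norm e)\<^sup>2 / \<nu> = 2 * ((norm e)\<^sup>2 / (2 * \<nu>))" by simp
    ultimately show ?thesis unfolding e_def by linarith
  qed
  have "(norm (gradF a - gradF b))\<^sup>2 / \<nu> = (norm (gradF b - gradF a))\<^sup>2 / (2 * \<nu>) +
      (norm (gradF a - gradF b))\<^sup>2 / (2 * \<nu>)"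
    by (simp add: norm_minus_commute)
  also have "\<dots> \<le> (gradF a - gradF b) \<bullet> (a - b)"
    using *[of a b] *[of b a] by (simp add: inner_diff_left inner_diff_right)
  finally show ?thesis .
qed

section \<open>Convergence of the primal-dual iteration\<close>

lemma tendsto_zero_if_norm_square_le:
  fixes Z :: "nat \<Rightarrow> 'a::real_normed_vector"
  assumes le: "\<And>k. a * (norm (Z k))\<^sup>2 \<le> W k" and W: "W \<longlonglongrightarrow> 0" and a: "a > 0"
  shows "Z \<longlonglongrightarrow> 0"
proof -
  have "(\<lambda>k. (norm (Z k))\<^sup>2) \<longlonglongrightarrow> 0"
  proof (rule tendsto_sandwich[where f = "\<lambda>_. 0" and h = "\<lambda>k. W k / a"])
    show "(\<lambda>k. W k / a) \<longlonglongrightarrow> 0" using tendsto_divide_zero[OF W] .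
    show "\<forall>\<^sub>F k in sequentially. (norm (Z k))\<^sup>2 \<le> W k / a"
      using le a by (simp add: pos_le_divide_eq mult.commute)
    show "\<forall>\<^sub>F k in sequentially. 0 \<le> (norm (Z k))\<^sup>2" by simp
  qed (rule tendsto_const)
  then show ?thesis by (simp add: tendsto_norm_zero_iff)
qed

lemma inner_diff_self_polar:
  fixes u v :: "'a::real_inner"
  shows "2 * ((u - v) \<bullet> v) = (norm u)\<^sup>2 - (norm v)\<^sup>2 - (norm (u - v))\<^sup>2"
  unfolding power2_norm_eq_inner
  by (simp add: inner_diff_left inner_diff_right inner_commute[of v u])

text \<open>One step of the iteration relative to a saddle point \<open>(x, y)\<close>: here \<open>a, a'\<close> are the dual
  errors before and after the step, \<open>b, b'\<close> their images under the adjoint, and \<open>e\<close>, \<open>d\<close>, \<open>q\<close> the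
  errors of \<open>x\<^sup>k\<close>, \<open>s\<^sup>k\<^sup>+\<^sup>1\<close> and of the gradient. The errors of \<open>p\<^sup>k\<close>, \<open>p\<^sup>k\<^sup>+\<^sup>1\<close> are then
  \<open>e + \<gamma> b'\<close> and \<open>d + \<gamma> b'\<close>.\<close>

lemma primal_dual_descent:
  fixes a a' :: "'b::real_inner" and b b' e d q :: "'a::real_inner"
  assumes pos: "\<gamma> > 0" "\<nu> > 0"
    and dual: "0 \<le> (a - a') \<bullet> a' / \<tau> - \<gamma> * ((b - b') \<bullet> b') + e \<bullet> b'"
    and primal: "0 \<le> ((1 / \<gamma>) *\<^sub>R (e - d) - b' - q) \<bullet> d"
    and coco: "(norm q)\<^sup>2 / \<nu> \<le> q \<bullet> e"
  shows "(norm a')\<^sup>2 / \<tau> - \<gamma> * (norm b')\<^sup>2 + (norm (d + \<gamma> *\<^sub>R b'))\<^sup>2 / \<gamma>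
      + ((norm (a - a'))\<^sup>2 / \<tau> - \<gamma> * (norm (b - b'))\<^sup>2) + (1 / \<gamma> - \<nu> / 2) * (norm (e - d))\<^sup>2
    \<le> (norm a)\<^sup>2 / \<tau> - \<gamma> * (norm b)\<^sup>2 + (norm (e + \<gamma> *\<^sub>R b'))\<^sup>2 / \<gamma>"
proof -
  \<comment> \<open>Together with \<open>h2\<close>, this polarizes the dual product in the metric
    \<open>1 / \<tau>\<close> minus \<open>\<gamma>\<close> times the composition of
    \<open>L\<close> with its adjoint.\<close>
  have h1: "2 * ((a - a') \<bullet> a' / \<tau>) = (norm a)\<^sup>2 / \<tau> - (norm a')\<^sup>2 / \<tau> - (norm (a - a'))\<^sup>2 / \<tau>"
    using arg_cong[OF inner_diff_self_polar[of a a'], of "\<lambda>t. t / \<tau>"] by (simp add: diff_divide_distrib)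
  have h2: "2 * (\<gamma> * ((b - b') \<bullet> b')) = \<gamma> * (norm b)\<^sup>2 - \<gamma> * (norm b')\<^sup>2 - \<gamma> * (norm (b - b'))\<^sup>2"
    using arg_cong[OF inner_diff_self_polar[of b b'], of "\<lambda>t. \<gamma> * t"] by (simp add: right_diff_distrib)
  \<comment> \<open>Polarizing the errors of \<open>p\<close> absorbs the coupling terms:
    \<open>e \<bullet> b'\<close> comes from the dual inequality, \<open>d \<bullet> b'\<close> from
    the primal one.\<close>
  have "(e + \<gamma> *\<^sub>R b') - (d + \<gamma> *\<^sub>R b') = e - d" by simp
  then have "2 * ((e - d) \<bullet> (d + \<gamma> *\<^sub>R b'))
      = (norm (e + \<gamma> *\<^sub>R b'))\<^sup>2 - (norm (d + \<gamma> *\<^sub>R b'))\<^sup>2 - (norm (e - d))\<^sup>2"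
    using inner_diff_self_polar[of "e + \<gamma> *\<^sub>R b'" "d + \<gamma> *\<^sub>R b'"] by metis
  from arg_cong[OF this, of "\<lambda>t. t / \<gamma>"] pos
  have h3: "2 * ((e - d) \<bullet> d / \<gamma>) + 2 * (e \<bullet> b') - 2 * (d \<bullet> b')
      = (norm (e + \<gamma> *\<^sub>R b'))\<^sup>2 / \<gamma> - (norm (d + \<gamma> *\<^sub>R b'))\<^sup>2 / \<gamma> - (norm (e - d))\<^sup>2 / \<gamma>"
    by (simp add: inner_add_right inner_diff_left[of _ _ b'] add_divide_distrib diff_divide_distrib algebra_simps)
  have h4: "0 \<le> (e - d) \<bullet> d / \<gamma> - d \<bullet> b' - q \<bullet> d"
    using primal by (simp add: inner_diff_left[of _ _ d] inner_commute[of b' d] diff_divide_distrib)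
  \<comment> \<open>Young's inequality, weighted so that the first term is exactly what cocoercivity
    pays for; the second, doubled, becomes the loss \<open>\<nu> / 2\<close>.\<close>
  have "q \<bullet> (e - d) \<le> (norm q)\<^sup>2 / \<nu> + \<nu> / 4 * (norm (e - d))\<^sup>2"
  proof -
    have "0 \<le> (norm (q - (\<nu> / 2) *\<^sub>R (e - d)))\<^sup>2 / \<nu>" using pos by simp
    also have "\<dots> = (norm q)\<^sup>2 / \<nu> - q \<bullet> (e - d) + \<nu> / 4 * (norm (e - d))\<^sup>2"
      unfolding norm_diff_scaleR_squared using pos
      by (simp add: add_divide_distrib diff_divide_distrib power2_eq_square[of "\<nu> / 2"])
    finally show ?thesis by simp
  qed
  then have h5: "q \<bullet> e - q \<bullet> d \<le> (norm q)\<^sup>2 / \<nu> + \<nu> / 4 * (norm (e - d))\<^sup>2"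
    by (simp add: inner_diff_right)
  have "(1 / \<gamma> - \<nu> / 2) * (norm (e - d))\<^sup>2 = (norm (e - d))\<^sup>2 / \<gamma> - 2 * (\<nu> / 4 * (norm (e - d))\<^sup>2)"
    by (simp add: algebra_simps)
  then show ?thesis using h1 h2 h3 h4 h5 dual coco by linarith
qed

text \<open>Add the subgradient inequalities of \<open>F\<close>, \<open>R\<close> and
  \<open>H\<close> composed with \<open>L\<close>: their slopes at \<open>x\<close> sum to
  zero.\<close>

lemma saddle_point_primal_minimizer:
  fixes L :: "'a::real_inner \<Rightarrow> 'b::real_inner"
  assumes L: "linear L" and adj: "\<And>x z. L x \<bullet> z = x \<bullet> Ls z"
    and proper: "proper_fun R" "proper_fun H"
    and F: "\<And>z. F x + g \<bullet> (z - x) \<le> F z"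
    and R: "- Ls y - g \<in> subdifferential R x" and H: "y \<in> subdifferential H (L x)"
  shows "is_arg_min (\<lambda>z. ereal (F z) + R z + H (L z)) (\<lambda>_. True) x"
proof -
  obtain a b where ab: "R x = ereal a" "H (L x) = ereal b"
    using subdifferential_finite proper R H by metis
  have "ereal (F x) + R x + H (L x) \<le> ereal (F z) + R z + H (L z)" for z
  proof -
    have "y \<bullet> (L z - L x) = Ls y \<bullet> (z - x)"
      by (metis L adj inner_commute linear_diff)
    then have "ereal (F x) + R x + H (L x) = ereal (F x + g \<bullet> (z - x))
        + (R x + ereal ((- Ls y - g) \<bullet> (z - x))) + (H (L x) + ereal (y \<bullet> (L z - L x)))"
      by (simp add: ab inner_diff_left[of _ _ "z - x"])
    also have "\<dots> \<le> ereal (F z) + R z + H (L z)"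
      using F subdifferentialD[OF R] subdifferentialD[OF H] by (intro add_mono) auto
    finally show ?thesis .
  qed
  then show ?thesis by (auto simp: is_arg_min_def not_less)
qed

text \<open>\<open>- Ls y\<close> is a subgradient of \<open>F + R\<close> at \<open>x\<close>.
  Fenchel's equality at \<open>y\<close>, Fenchel's inequality at \<open>z\<close> and the
  subgradient \<open>L x\<close> of the conjugate of \<open>H\<close> combine, and the linear terms
  cancel.\<close>

lemma saddle_point_dual_minimizer:
  fixes L :: "'a::real_inner \<Rightarrow> 'b::real_inner"
  assumes adj: "\<And>x z. L x \<bullet> z = x \<bullet> Ls z"
    and proper: "proper_fun R"
    and F: "\<And>z. F x + g \<bullet> (z - x) \<le> F z"
    and R: "- Ls y - g \<in> subdifferential R x" and H: "L x \<in> subdifferential (conjugate H) y"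
  shows "is_arg_min (\<lambda>z. conjugate (\<lambda>w. ereal (F w) + R w) (- Ls z) + conjugate H z) (\<lambda>_. True) y"
proof -
  let ?G = "\<lambda>w. ereal (F w) + R w"
  obtain a where a: "R x = ereal a" using subdifferential_finite proper R by metis
  have "?G x + ereal ((- Ls y) \<bullet> (z - x)) \<le> ?G z" for z
  proof -
    have "?G x + ereal ((- Ls y) \<bullet> (z - x))
        = ereal (F x + g \<bullet> (z - x)) + (R x + ereal ((- Ls y - g) \<bullet> (z - x)))"
      by (simp add: a inner_diff_left[of _ _ "z - x"])
    also have "\<dots> \<le> ?G z"
      using F subdifferentialD[OF R] by (intro add_mono) auto
    finally show ?thesis .
  qed
  then have sub: "- Ls y \<in> subdifferential ?G x" by (simp add: subdifferential_def)
  have "proper_fun ?G" using proper by (auto simp: proper_fun_def)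
  note cy = conjugate_at_subgradient[OF this sub]
  have "conjugate ?G (- Ls y) + conjugate H y \<le> conjugate ?G (- Ls z) + conjugate H z" for z
  proof -
    have "conjugate ?G (- Ls y) + conjugate H y
        = (ereal (x \<bullet> (- Ls z)) - ?G x) + (conjugate H y + ereal (L x \<bullet> (z - y)))"
      by (cases "conjugate H y") (simp_all add: cy a adj inner_diff_right)
    also have "\<dots> \<le> conjugate ?G (- Ls z) + conjugate H z"
      by (intro add_mono conjugate_ge subdifferentialD[OF H])
    finally show ?thesis .
  qed
  then show ?thesis by (auto simp: is_arg_min_def not_less)
qed

theorem theorem4p1:
  fixes L :: "'a::real_inner \<Rightarrow> 'b::real_inner"
    and F :: "'a \<Rightarrow> real" and gradF :: "'a \<Rightarrow> 'a"
    and R :: "'a \<Rightarrow> ereal" and H :: "'b \<Rightarrow> ereal"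
    and \<nu> \<gamma> \<tau> :: real
    and x s p :: "nat \<Rightarrow> 'a" and y :: "nat \<Rightarrow> 'b"
  assumes fin_dim_X: "\<exists>B :: 'a set. finite B \<and> span B = UNIV"
    and fin_dim_Y: "\<exists>B :: 'b set. finite B \<and> span B = UNIV"
    and L: "linear L"
    and F_convex: "convex_on UNIV F"
    and nu: "\<nu> > 0"
    and F_grad: "\<And>z. GDERIV F z :> gradF z"
    and F_smooth: "\<nu>-lipschitz_on UNIV gradF"
    and R: "proper_fun R" "convex_fun R" "lsc R"
    and H: "proper_fun H" "convex_fun H" "lsc H"
    and standing: "\<exists>xh. 0 \<in> {gradF xh + r + adjoint L h | r h.
                      r \<in> subdifferential R xh \<and> h \<in> subdifferential H (L xh)}"
    and gamma: "\<gamma> > 0" "\<gamma> < 2 / \<nu>"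
    and tau: "\<tau> > 0" "\<tau> * \<gamma> * (onorm L)\<^sup>2 < 1"
    and y_step: "\<And>k. y (Suc k) =
          prox (\<lambda>z. ereal \<tau> * conjugate H z)
            (y k + \<tau> *\<^sub>R L (p k - \<gamma> *\<^sub>R adjoint L (y k)))"
    and x_step: "\<And>k. x k = p k - \<gamma> *\<^sub>R adjoint L (y (Suc k))"
    and s_step: "\<And>k. s (Suc k) =
          prox (\<lambda>z. ereal \<gamma> * R z) (2 *\<^sub>R x k - p k - \<gamma> *\<^sub>R gradF (x k))"
    and p_step: "\<And>k. p (Suc k) = p k + s (Suc k) - x k"
  shows "(\<exists>x_star. x \<longlonglongrightarrow> x_star \<and> s \<longlonglongrightarrow> x_star \<and>
            is_arg_min (\<lambda>z. ereal (F z) + R z + H (L z)) (\<lambda>_. True) x_star) \<and>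
         (\<exists>y_star. y \<longlonglongrightarrow> y_star \<and>
            is_arg_min (\<lambda>z. conjugate (\<lambda>w. ereal (F w) + R w) (- adjoint L z) + conjugate H z)
              (\<lambda>_. True) y_star)"
proof -

  \<comment> \<open>Adjoint, boundedness and the step-size constants\<close>
  obtain BX :: "'a set" where BX: "finite BX" "span BX = UNIV" using fin_dim_X by blast
  obtain BY :: "'b set" where BY: "finite BY" "span BY = UNIV" using fin_dim_Y by blast
  define Ls where "Ls = adjoint L"
  have adj: "L u \<bullet> z = u \<bullet> Ls z" for u z
    unfolding Ls_def by (rule finite_span_adjoint_works[OF BX L])
  have blL: "bounded_linear L" by (rule finite_span_bounded_linear[OF BX L])
  have linLs: "linear Ls" using adjoint_linear_of_inner adj by blast
  have blLs: "bounded_linear Ls" by (rule finite_span_bounded_linear[OF BY linLs])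
  note tendstoL = bounded_linear.tendsto[OF blL]
  note tendstoLs = bounded_linear.tendsto[OF blLs]
  \<comment> \<open>Coercivity constant of the dual part of the energy; its positivity is the
    condition \<open>\<tau> * \<gamma> * (onorm L)\<^sup>2 < 1\<close>, as that of
    \<open>\<kappa>\<close> below is \<open>\<gamma> < 2 / \<nu>\<close>.\<close>
  define c where "c = 1 / \<tau> - \<gamma> * (onorm L)\<^sup>2"
  have c: "c > 0" using tau by (simp add: c_def field_simps)
  have coercive: "c * (norm a)\<^sup>2 \<le> (norm a)\<^sup>2 / \<tau> - \<gamma> * (norm (Ls a))\<^sup>2" for a
  proof -
    have "(norm (Ls a))\<^sup>2 \<le> (onorm L)\<^sup>2 * (norm a)\<^sup>2"
      using power_mono[OF adjoint_bound[OF blL adj, of a], of 2] by (simp add: power_mult_distrib)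
    from mult_left_mono[OF this, of \<gamma>] gamma(1) show ?thesis
      by (simp add: c_def left_diff_distrib)
  qed
  define \<kappa> where "\<kappa> = 1 / \<gamma> - \<nu> / 2"
  have \<kappa>: "\<kappa> > 0" using gamma nu by (simp add: \<kappa>_def field_simps)

  \<comment> \<open>Saddle points and the inclusions satisfied by the iterates\<close>
  define saddle where "saddle u w \<longleftrightarrow>
    L u \<in> subdifferential (conjugate H) w \<and> - Ls w - gradF u \<in> subdifferential R u" for u w
  obtain xh rh yh where h: "gradF xh + rh + Ls yh = 0" "rh \<in> subdifferential R xh"
    "yh \<in> subdifferential H (L xh)"
    using standing unfolding Ls_def by force
  \<comment> \<open>Besides turning the standing assumption into a saddle point, this is the
    subgradient that makes the dual prox well-defined.\<close>
  have Lxh: "L xh \<in> subdifferential (conjugate H) yh" by (rule subgradient_conjugate[OF H(1) h(3)])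
  have "rh = - Ls yh - gradF xh"
    using h(1) by (metis add.commute add_diff_cancel diff_0 diff_diff_add minus_add_distrib uminus_add_conv_diff)
  then have saddle_h: "saddle xh yh" using h(2) Lxh by (simp add: saddle_def)
  note Hc = proper_conjugate[OF H(1) h(3)] convex_conjugate[OF H(1)] lsc_conjugate[OF H(1)]

  have dual_incl: "(1 / \<tau>) *\<^sub>R (y k - y (Suc k)) + L (p k - \<gamma> *\<^sub>R Ls (y k))
      \<in> subdifferential (conjugate H) (y (Suc k))" for k
    using prox_subgradient[OF BY Hc Lxh tau(1) y_step[of k]] tau(1)
    by (simp add: Ls_def scaleR_right_diff_distrib scaleR_add_right algebra_simps)
  have primal_incl: "(1 / \<gamma>) *\<^sub>R (x k - s (Suc k)) - Ls (y (Suc k)) - gradF (x k)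
      \<in> subdifferential R (s (Suc k))" for k
  proof -
    \<comment> \<open>Eliminating \<open>p k\<close> turns \<open>2 *\<^sub>R x k - p k\<close> into
      \<open>x k\<close> minus the dual term at the new \<open>y (Suc k)\<close>.\<close>
    have "p k = x k + \<gamma> *\<^sub>R Ls (y (Suc k))" using x_step[of k] by (simp add: Ls_def)
    then have "2 *\<^sub>R x k - p k - \<gamma> *\<^sub>R gradF (x k) - s (Suc k)
        = (x k - s (Suc k)) - \<gamma> *\<^sub>R (Ls (y (Suc k)) + gradF (x k))"
      by (simp add: scaleR_2 algebra_simps)
    then have "(1 / \<gamma>) *\<^sub>R (2 *\<^sub>R x k - p k - \<gamma> *\<^sub>R gradF (x k) - s (Suc k))
        = (1 / \<gamma>) *\<^sub>R (x k - s (Suc k)) - Ls (y (Suc k)) - gradF (x k)"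
      using gamma(1) by (simp add: scaleR_diff_right)
    then show ?thesis
      using prox_subgradient[OF BX R h(2) gamma(1) s_step[of k]] by simp
  qed

  \<comment> \<open>Descent of the energy and vanishing gaps\<close>
  define V where "V u w k = (norm (y k - w))\<^sup>2 / \<tau> - \<gamma> * (norm (Ls (y k - w)))\<^sup>2
    + (norm (p k - (u + \<gamma> *\<^sub>R Ls w)))\<^sup>2 / \<gamma>" for u w k
  have descent: "V u w (Suc k) + c * (norm (y k - y (Suc k)))\<^sup>2 + \<kappa> * (norm (x k - s (Suc k)))\<^sup>2
      \<le> V u w k" if uw: "saddle u w" for u w k
  proof -
    let ?a = "y k - w" and ?a' = "y (Suc k) - w"
    let ?b = "Ls (y k - w)" and ?b' = "Ls (y (Suc k) - w)"
    let ?e = "x k - u" and ?d = "s (Suc k) - u" and ?q = "gradF (x k) - gradF u"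
    have Lsd: "Ls (v - v') = Ls v - Ls v'" for v v' by (rule linear_diff[OF linLs])
    have Ld: "L (v - v') = L v - L v'" for v v' by (rule linear_diff[OF L])
    have pk: "p k = x k + \<gamma> *\<^sub>R Ls (y (Suc k))" using x_step[of k] by (simp add: Ls_def)
    have "0 \<le> ((1 / \<tau>) *\<^sub>R (y k - y (Suc k)) + L (p k - \<gamma> *\<^sub>R Ls (y k)) - L u) \<bullet> ?a'"
      using subdifferential_monotone[OF Hc(1) dual_incl] uw by (simp add: saddle_def)
    also have "\<dots> = (?a - ?a') \<bullet> ?a' / \<tau> + L (p k - \<gamma> *\<^sub>R Ls (y k) - u) \<bullet> ?a'"
      by (simp add: Ld inner_add_left inner_diff_left[of _ _ ?a'])
    \<comment> \<open>The dual step uses the old \<open>y k\<close> while \<open>x k\<close> uses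
      \<open>y (Suc k)\<close>; the correction is what yields the negative term of the dual
      metric.\<close>
    also have "p k - \<gamma> *\<^sub>R Ls (y k) - u = ?e - \<gamma> *\<^sub>R (?b - ?b')"
      by (simp add: pk Lsd algebra_simps)
    also have "(?a - ?a') \<bullet> ?a' / \<tau> + L (?e - \<gamma> *\<^sub>R (?b - ?b')) \<bullet> ?a'
        = (?a - ?a') \<bullet> ?a' / \<tau> - \<gamma> * ((?b - ?b') \<bullet> ?b') + ?e \<bullet> ?b'"
      unfolding adj by (simp add: inner_diff_left[of _ _ ?b'] right_diff_distrib)
    finally have dual: "0 \<le> (?a - ?a') \<bullet> ?a' / \<tau> - \<gamma> * ((?b - ?b') \<bullet> ?b') + ?e \<bullet> ?b'" .
    have eq: "(1 / \<gamma>) *\<^sub>R (?e - ?d) - ?b' - ?q = (1 / \<gamma>) *\<^sub>R (x k - s (Suc k)) - Ls (y (Suc k))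
        - gradF (x k) - (- Ls w - gradF u)"
      by (simp add: Lsd)
    have primal: "0 \<le> ((1 / \<gamma>) *\<^sub>R (?e - ?d) - ?b' - ?q) \<bullet> ?d"
      unfolding eq
      by (rule subdifferential_monotone[OF R(1) primal_incl]) (use uw in \<open>simp add: saddle_def\<close>)
    have coco: "(norm ?q)\<^sup>2 / \<nu> \<le> ?q \<bullet> ?e"
      by (rule lipschitz_gradient_cocoercive[OF F_convex F_grad F_smooth nu])
    have e: "?e + \<gamma> *\<^sub>R ?b' = p k - (u + \<gamma> *\<^sub>R Ls w)"
      by (simp add: pk Lsd algebra_simps)
    have d: "?d + \<gamma> *\<^sub>R ?b' = p (Suc k) - (u + \<gamma> *\<^sub>R Ls w)"
      by (simp add: p_step pk Lsd algebra_simps)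
    have ab: "?a - ?a' = y k - y (Suc k)" "?b - ?b' = Ls (y k - y (Suc k))" "?e - ?d = x k - s (Suc k)"
      by (simp_all add: Lsd)
    show ?thesis
      using primal_dual_descent[OF gamma(1) nu dual primal coco] coercive[of "y k - y (Suc k)"]
      unfolding V_def \<kappa>_def ab e d by linarith
  qed
  have bound: "c * (norm (y k - w))\<^sup>2 + (norm (p k - (u + \<gamma> *\<^sub>R Ls w)))\<^sup>2 / \<gamma> \<le> V u w k" for u w k
    using coercive[of "y k - w"] by (simp add: V_def)
  have V_nonneg: "0 \<le> V u w k" for u w k
    by (rule order_trans[OF _ bound]) (use c gamma(1) in simp)
  have V_dec: "decseq (V u w)" if "saddle u w" for u w
  proof (rule decseq_SucI)
    have "0 \<le> c * (norm (y k - y (Suc k)))\<^sup>2" "0 \<le> \<kappa> * (norm (x k - s (Suc k)))\<^sup>2" for k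
      using c \<kappa> by simp_all
    then show "V u w (Suc k) \<le> V u w k" for k using descent[OF that, of k] by (smt (verit))
  qed
  have "\<exists>l. V xh yh \<longlonglongrightarrow> l"
    using decseq_convergent[OF V_dec[OF saddle_h], of 0] V_nonneg by metis
  then obtain l where "V xh yh \<longlonglongrightarrow> l" by blast
  \<comment> \<open>The energy is nonincreasing and nonnegative, so it converges and its successive
    differences, which dominate both gaps, vanish.\<close>
  then have gap: "(\<lambda>k. V xh yh k - V xh yh (Suc k)) \<longlonglongrightarrow> 0"
    using tendsto_diff[OF _ LIMSEQ_Suc] by fastforce
  have dy: "(\<lambda>k. y k - y (Suc k)) \<longlonglongrightarrow> 0"
  proof (rule tendsto_zero_if_norm_square_le[OF _ gap c])
    fix k
    have "0 \<le> \<kappa> * (norm (x k - s (Suc k)))\<^sup>2" using \<kappa> by simp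
    then show "c * (norm (y k - y (Suc k)))\<^sup>2 \<le> V xh yh k - V xh yh (Suc k)"
      using descent[OF saddle_h, of k] by linarith
  qed
  have dx: "(\<lambda>k. x k - s (Suc k)) \<longlonglongrightarrow> 0"
  proof (rule tendsto_zero_if_norm_square_le[OF _ gap \<kappa>])
    fix k
    have "0 \<le> c * (norm (y k - y (Suc k)))\<^sup>2" using c by simp
    then show "\<kappa> * (norm (x k - s (Suc k)))\<^sup>2 \<le> V xh yh k - V xh yh (Suc k)"
      using descent[OF saddle_h, of k] by linarith
  qed

  \<comment> \<open>A cluster point of the bounded iterates\<close>
  have V_le: "V xh yh k \<le> V xh yh 0" for k
    using V_dec[OF saddle_h] by (simp add: decseq_def)
  have "norm (y k) \<le> norm yh + sqrt (V xh yh 0 / c)" for k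
  proof -
    have "0 \<le> (norm (p k - (xh + \<gamma> *\<^sub>R Ls yh)))\<^sup>2 / \<gamma>" using gamma(1) by simp
    then have "c * (norm (y k - yh))\<^sup>2 \<le> V xh yh 0" using bound[of k yh xh] V_le[of k] by linarith
    then have "norm (y k - yh) \<le> sqrt (V xh yh 0 / c)"
      using c by (intro real_le_rsqrt) (simp add: field_simps)
    then show ?thesis using norm_triangle_sub[of "y k" yh] by linarith
  qed
  then obtain yb r1 where r1: "strict_mono r1" "(\<lambda>k. y (r1 k)) \<longlonglongrightarrow> yb"
    using finite_span_bounded_subsequence[OF BY] by metis
  have "norm (p k) \<le> norm (xh + \<gamma> *\<^sub>R Ls yh) + sqrt (V xh yh 0 * \<gamma>)" for k
  proof -
    have "0 \<le> c * (norm (y k - yh))\<^sup>2" using c by simp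
    then have "(norm (p k - (xh + \<gamma> *\<^sub>R Ls yh)))\<^sup>2 / \<gamma> \<le> V xh yh 0"
      using bound[of k yh xh] V_le[of k] by linarith
    then have "norm (p k - (xh + \<gamma> *\<^sub>R Ls yh)) \<le> sqrt (V xh yh 0 * \<gamma>)"
      using gamma(1) by (intro real_le_rsqrt) (simp add: pos_divide_le_eq)
    then show ?thesis using norm_triangle_sub[of "p k" "xh + \<gamma> *\<^sub>R Ls yh"] by linarith
  qed
  \<comment> \<open>The second extraction runs inside the first, so \<open>y\<close> and
    \<open>p\<close> converge along the common subsequence \<open>r\<close>.\<close>
  then obtain pb r2 where r2: "strict_mono r2" "(\<lambda>k. p (r1 (r2 k))) \<longlonglongrightarrow> pb"
    using finite_span_bounded_subsequence[OF BX, of "\<lambda>k. p (r1 k)"] by metis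
  define r where "r k = r1 (r2 k)" for k
  have r: "strict_mono r" using r1(1) r2(1) by (simp add: r_def strict_mono_def)
  have yr: "(\<lambda>k. y (r k)) \<longlonglongrightarrow> yb"
    using LIMSEQ_subseq_LIMSEQ[OF r1(2) r2(1)] by (simp add: r_def o_def)
  have pr: "(\<lambda>k. p (r k)) \<longlonglongrightarrow> pb" using r2(2) by (simp add: r_def)
  have dyr: "(\<lambda>k. y (r k) - y (Suc (r k))) \<longlonglongrightarrow> 0"
    using LIMSEQ_subseq_LIMSEQ[OF dy r] by (simp add: o_def)
  have dxr: "(\<lambda>k. x (r k) - s (Suc (r k))) \<longlonglongrightarrow> 0"
    using LIMSEQ_subseq_LIMSEQ[OF dx r] by (simp add: o_def)
  \<comment> \<open>The inclusions mix indices \<open>r k\<close> and \<open>Suc (r k)\<close>; the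
    vanishing gaps give both the same limit.\<close>
  have ysr: "(\<lambda>k. y (Suc (r k))) \<longlonglongrightarrow> yb"
    using tendsto_diff[OF yr dyr] by simp
  define xb where "xb = pb - \<gamma> *\<^sub>R Ls yb"
  have xr: "(\<lambda>k. x (r k)) \<longlonglongrightarrow> xb"
    unfolding x_step xb_def Ls_def[symmetric] by (intro tendsto_intros pr tendstoLs ysr)
  have sr: "(\<lambda>k. s (Suc (r k))) \<longlonglongrightarrow> xb"
    using tendsto_diff[OF xr dxr] by simp
  have "isCont gradF xb"
    using lipschitz_on_continuous_on[OF F_smooth] by (simp add: continuous_on_eq_continuous_at)
  then have gr: "(\<lambda>k. gradF (x (r k))) \<longlonglongrightarrow> gradF xb" using xr by (rule isCont_tendsto_compose)

  \<comment> \<open>The cluster point is a saddle point\<close>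
  have "(\<lambda>k. (1 / \<tau>) *\<^sub>R (y (r k) - y (Suc (r k))) + L (p (r k) - \<gamma> *\<^sub>R Ls (y (r k))))
      \<longlonglongrightarrow> (1 / \<tau>) *\<^sub>R 0 + L (pb - \<gamma> *\<^sub>R Ls yb)"
    by (intro tendsto_intros dyr tendstoL pr tendstoLs yr)
  from subdifferential_closed[OF Hc(1,3) ysr this dual_incl]
  have dual_b: "L xb \<in> subdifferential (conjugate H) yb" by (simp add: xb_def)
  have "(\<lambda>k. (1 / \<gamma>) *\<^sub>R (x (r k) - s (Suc (r k))) - Ls (y (Suc (r k))) - gradF (x (r k)))
      \<longlonglongrightarrow> (1 / \<gamma>) *\<^sub>R 0 - Ls yb - gradF xb"
    by (intro tendsto_intros dxr tendstoLs ysr gr)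
  from subdifferential_closed[OF R(1,3) sr this primal_incl]
  have primal_b: "- Ls yb - gradF xb \<in> subdifferential R xb" by simp
  have saddle_b: "saddle xb yb" using dual_b primal_b by (simp add: saddle_def)

  \<comment> \<open>Convergence of the whole sequences\<close>
  obtain l' where l': "V xb yb \<longlonglongrightarrow> l'"
    using decseq_convergent[OF V_dec[OF saddle_b], of 0] V_nonneg by metis
  have pb: "xb + \<gamma> *\<^sub>R Ls yb = pb" by (simp add: xb_def)
  have "(\<lambda>k. V xb yb (r k)) \<longlonglongrightarrow> (norm (yb - yb))\<^sup>2 / \<tau> - \<gamma> * (norm (Ls (yb - yb)))\<^sup>2
      + (norm (pb - pb))\<^sup>2 / \<gamma>"
    unfolding V_def pb using tau(1) gamma(1) by (intro tendsto_intros yr pr tendstoLs) auto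
  then have "(\<lambda>k. V xb yb (r k)) \<longlonglongrightarrow> 0" by (simp add: linear_0[OF linLs])
  moreover have "(\<lambda>k. V xb yb (r k)) \<longlonglongrightarrow> l'"
    using LIMSEQ_subseq_LIMSEQ[OF l' r] by (simp add: o_def)
  \<comment> \<open>The full energy sequence relative to \<open>(xb, yb)\<close> converges, and its
    limit is read off along \<open>r\<close>.\<close>
  ultimately have V0: "V xb yb \<longlonglongrightarrow> 0" using l' LIMSEQ_unique by blast
  have "(\<lambda>k. y k - yb) \<longlonglongrightarrow> 0"
  proof (rule tendsto_zero_if_norm_square_le[OF _ V0 c])
    fix k
    have "0 \<le> (norm (p k - (xb + \<gamma> *\<^sub>R Ls yb)))\<^sup>2 / \<gamma>" using gamma(1) by simp
    then show "c * (norm (y k - yb))\<^sup>2 \<le> V xb yb k" using bound[of k yb xb] by linarith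
  qed
  then have y_lim: "y \<longlonglongrightarrow> yb" by (simp add: LIM_zero_iff)
  have "(\<lambda>k. p k - pb) \<longlonglongrightarrow> 0"
  proof (rule tendsto_zero_if_norm_square_le[OF _ V0, of "1 / \<gamma>"])
    fix k
    have "0 \<le> c * (norm (y k - yb))\<^sup>2" using c by simp
    then show "1 / \<gamma> * (norm (p k - pb))\<^sup>2 \<le> V xb yb k" using bound[of k yb xb] by (simp add: pb)
  qed (use gamma(1) in simp)
  then have p_lim: "p \<longlonglongrightarrow> pb" by (simp add: LIM_zero_iff)
  have x_lim: "x \<longlonglongrightarrow> xb"
    unfolding x_step[abs_def] xb_def Ls_def[symmetric]
    by (intro tendsto_intros p_lim tendstoLs LIMSEQ_Suc y_lim)
  \<comment> \<open>The recursion starts at \<open>s (Suc 0)\<close>; the arbitrary value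
    \<open>s 0\<close> does not affect the limit.\<close>
  have "(\<lambda>k. s (Suc k)) \<longlonglongrightarrow> xb"
    using tendsto_diff[OF x_lim dx] by simp
  then have s_lim: "s \<longlonglongrightarrow> xb" by (rule LIMSEQ_imp_Suc)

  \<comment> \<open>Optimality of the limits\<close>
  have grad_b: "F xb + gradF xb \<bullet> (z - xb) \<le> F z" for z
    by (rule convex_gradient_ineq[OF F_convex F_grad])
  have yb: "yb \<in> subdifferential H (L xb)"
    by (rule conjugate_subgradient[OF BY H h(3) dual_b])
  have "is_arg_min (\<lambda>z. ereal (F z) + R z + H (L z)) (\<lambda>_. True) xb"
    by (rule saddle_point_primal_minimizer[OF L adj R(1) H(1) grad_b primal_b yb])
  moreover have "is_arg_min (\<lambda>z. conjugate (\<lambda>w. ereal (F w) + R w) (- adjoint L z) + conjugate H z)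
      (\<lambda>_. True) yb"
    using saddle_point_dual_minimizer[OF adj R(1) grad_b primal_b dual_b] by (simp add: Ls_def)
  ultimately show ?thesis using x_lim s_lim y_lim by blast
qed

end
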